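(* Let $\phi(\eta_1,\eta_2)$ and the coefficients $W,W_{\mathrm{fp}},W_{\mathrm{fn}},\bar T_{\mathrm{lo}},\bar T_{\mathrm{hi,p}},\bar T_{\mathrm{hi,n}}$ be as defined in the context, and let $\mathcal H=[\rho_1,1]\times[\rho_2,1]$ with $\rho_1,\rho_2\in(0,1)$. Compute the minimiser $(\bar\eta_1,\bar\eta_2)$ and minimal value $\bar\phi$ of $\phi$ in $(0,\infty)^2$, if they exist; namely, if $W>W_{\mathrm{fp}}+W_{\mathrm{fn}}$, $$\bar\phi=\left(\sqrt{(W-W_{\mathrm{fp}}-W_{\mathrm{fn}})\bar T_{\mathrm{lo}}}+\sqrt{W_{\mathrm{fp}}\bar T_{\mathrm{hi,p}}}+\sqrt{W_{\mathrm{fn}}\bar T_{\mathrm{hi,n}}}\right)^2,$$ $$(\bar\eta_1,\bar\eta_2)=\left(\sqrt{\frac{\bar T_{\mathrm{lo}}}{W-W_{\mathrm{fp}}-W_{\mathrm{fn}}}\cdot\frac{W_{\mathrm{fp}}}{\bar T_{\mathrm{hi,p}}}},\ \sqrt{\frac{\bar T_{\mathrm{lo}}}{W-W_{\mathrm{fp}}-W_{\mathrm{fn}}}\cdot\frac{W_{\mathrm{fn}}}{\bar T_{\mathrm{hi,n}}}}\right),$$ while if $W\le W_{\mathrm{fp}}+W_{\mathrm{fn}}$ they do not exist. If $(\bar\eta_1,\bar\eta_2)\in\mathcal H$, then set $(\eta_1^\star,\eta_2^\star)=(\bar\eta_1,\bar\eta_2)$ and $\phi^\star=\bar\phi$. Otherwise,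 set $\phi^\star$ equal to the minimum of the four values $$\phi(1,\eta_2(1)),\quad \phi(\eta_1(1),1),\quad \phi(\rho_1,\eta_2(\rho_1)),\quad \phi(\eta_1(\rho_2),\rho_2),$$ and $(\eta_1^\star,\eta_2^\star)$ to the associated argument, where for $x>0$ $$\eta_1(x)=\max\left\{\rho_1,\ \min\left[1,\ \sqrt{\frac{\bar T_{\mathrm{lo}}+\bar T_{\mathrm{hi,n}}x}{W-W_{\mathrm{fp}}-(1-x^{-1})W_{\mathrm{fn}}}\cdot\frac{W_{\mathrm{fp}}}{\bar T_{\mathrm{hi,p}}}}\ \right]\right\},$$ $$\eta_2(x)=\max\left\{\rho_2,\ \min\left[1,\ \sqrt{\frac{\bar T_{\mathrm{lo}}+\bar T_{\mathrm{hi,p}}x}{W-(1-x^{-1})W_{\mathrm{fp}}-W_{\mathrm{fn}}}\cdot\frac{W_{\mathrm{fn}}}{\bar T_{\mathrm{hi,n}}}}\ \right]\right\}.$$ Then $\phi^\star$ is the minimum value of $\phi$ over $(\eta_1,\eta_2)\in\mathcal H$, and $(\eta_1^\star,\eta_2^\star)$ are the minimising continuation probabilities, i.e. the minimising values of $(\eta_1,\eta_2)$.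
   Context: Setting. $\Theta$ is a parameter space and $\mathcal Y$ a data space; $\pi$ is a prior probability density on $\Theta$; $f(\cdot\mid\theta)$ (high-fidelity model) and $\tilde f(\cdot\mid\theta)$ (low-fidelity model) are conditional densities on $\mathcal Y$, and $\check f(\tilde y,y\mid\theta)$ is a coupling, i.e. a joint density on $\mathcal Y^2$ with marginals $\tilde f(\tilde y\mid\theta)$ and $f(y\mid\theta)$. $\Omega_\epsilon=\{y\in\mathcal Y:d(y,y_{\mathrm{obs}})<\epsilon\}$ for observed data $y_{\mathrm{obs}}\in\mathcal Y$, a metric $d$ and $\epsilon>0$. $q$ is a known non-negative function on $\Theta$, with $q>0$ on the support of $\pi$, whose normalisation is the importance distribution. $T(\tilde y)$ is the computational cost of simulating $\tilde y\sim\tilde f(\cdot\mid\theta)$ and $T(y)$ is the cost of then simulating $y$ from its conditional law given $\tilde y$ under $\check f$. Write $\mathbb P_\theta,\mathbb E_\theta$ for probability and expectation when $(\tilde y,y)\sim\check f(\cdot,\cdot\mid\theta)$. The coefficients are $$W=\int\frac{\pi(\theta)^2}{q(\theta)}\mathbb P_\theta(y\in\Omega_\epsilon)\,\mathrm d\theta,\quad W_{\mathrm{fp}}=\int\frac{\pi(\theta)^2}{q(\theta)}\mathbb P_\theta(\tilde y\in\Omega_\epsilon,\,y\notin\Omega_\epsilon)\,\mathrm d\theta,\quad W_{\mathrm{fn}}=\int\frac{\pi(\theta)^2}{q(\theta)}\mathbb P_\theta(\tilde y\notin\Omega_\epsilon,\,y\in\Omega_\epsilon)\,\mathrm d\theta,$$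 $$\bar T_{\mathrm{lo}}=\int\mathbb E_\theta[T(\tilde y)]\,q(\theta)\,\mathrm d\theta,\quad \bar T_{\mathrm{hi,p}}=\int\mathbb E_\theta[T(y)\mathbb I(\tilde y\in\Omega_\epsilon)]\,q(\theta)\,\mathrm d\theta,\quad \bar T_{\mathrm{hi,n}}=\int\mathbb E_\theta[T(y)\mathbb I(\tilde y\notin\Omega_\epsilon)]\,q(\theta)\,\mathrm d\theta.$$ The function $\phi$ is $$\phi(\eta_1,\eta_2)=\left(W+\left(\tfrac1{\eta_1}-1\right)W_{\mathrm{fp}}+\left(\tfrac1{\eta_2}-1\right)W_{\mathrm{fn}}\right)\left(\bar T_{\mathrm{lo}}+\eta_1\bar T_{\mathrm{hi,p}}+\eta_2\bar T_{\mathrm{hi,n}}\right).$$ Here $\eta_1$ (respectively $\eta_2$) is the continuation probability: the probability of simulating the high-fidelity output $y$ after a low-fidelity output $\tilde y\in\Omega_\epsilon$ (respectively $\tilde y\notin\Omega_\epsilon$).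
   Formalization: Costs are taken strictly positive; the minimiser on (0,∞)² is claimed only if W_fp, W_fn > 0 (else η̄ has a zero or undefined entry), nonexistence only if W_fp+W_fn > 0 (else φ ≡ 0); in η_1(x), η_2(x), the root is read as +∞ where its denominator W−… is ≤ 0. *)

theory Defs
  imports "HOL-Probability.Probability"
begin

text \<open>
  The data of a multifidelity ABC problem. The measure \<open>par_space\<close> plays the role of the
  parameter space with its reference measure (the \<open>d\<theta>\<close> of the integrals), \<open>data_space\<close> that of
  the data space with its reference measure; all densities are taken with respect to these.
  The two costs written \<open>T(y\<^sup>~)\<close> and \<open>T(y)\<close> in the literature are different functions, because
  the second is the cost of simulating \<open>y\<close> given \<open>y\<^sup>~\<close>. They are allowed to depend on
  everything known at the time of simulation: \<open>cost_lo \<theta> y\<^sup>~\<close> and \<open>cost_hi \<theta> y\<^sup>~ y\<close>.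
  In functions of two data points the low-fidelity one comes first.
\<close>

record ('t, 'y) mf_model =
  par_space :: "'t measure"
  data_space :: "'y measure"
  prior :: "'t \<Rightarrow> real"
  hifi :: "'t \<Rightarrow> 'y \<Rightarrow> real"
  lofi :: "'t \<Rightarrow> 'y \<Rightarrow> real"
  coupling :: "'t \<Rightarrow> 'y \<Rightarrow> 'y \<Rightarrow> real"
  metric :: "'y \<Rightarrow> 'y \<Rightarrow> real"
  y_obs :: "'y"
  eps :: real
  importance :: "'t \<Rightarrow> real"
  cost_lo :: "'t \<Rightarrow> 'y \<Rightarrow> real"
  cost_hi :: "'t \<Rightarrow> 'y \<Rightarrow> 'y \<Rightarrow> real"

definition Omega :: "('t, 'y) mf_model \<Rightarrow> 'y set" where
  "Omega S = {y \<in> space (data_space S). metric S y (y_obs S) < eps S}"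

text \<open>The law of the pair \<open>(y\<^sup>~, y)\<close> under \<open>\<theta>\<close>, behind \<open>P\<^sub>\<theta>\<close> and \<open>E\<^sub>\<theta>\<close>.\<close>

definition pair_law :: "('t, 'y) mf_model \<Rightarrow> 't \<Rightarrow> ('y \<times> 'y) measure" where
  "pair_law S \<theta> = density (data_space S \<Otimes>\<^sub>M data_space S) (\<lambda>(yl, y). ennreal (coupling S \<theta> yl y))"

text \<open>Where \<open>importance\<close> vanishes so does \<open>prior\<close>, and the weight \<open>0 / 0\<close> is \<open>0\<close>, as intended.\<close>

definition W :: "('t, 'y) mf_model \<Rightarrow> real" where
  "W S = (\<integral>\<theta>. (prior S \<theta>)\<^sup>2 / importance S \<theta> *
     measure (pair_law S \<theta>) {(yl, y) \<in> space (pair_law S \<theta>). y \<in> Omega S} \<partial>par_space S)"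

definition W_fp :: "('t, 'y) mf_model \<Rightarrow> real" where
  "W_fp S = (\<integral>\<theta>. (prior S \<theta>)\<^sup>2 / importance S \<theta> *
     measure (pair_law S \<theta>) {(yl, y) \<in> space (pair_law S \<theta>). yl \<in> Omega S \<and> y \<notin> Omega S} \<partial>par_space S)"

definition W_fn :: "('t, 'y) mf_model \<Rightarrow> real" where
  "W_fn S = (\<integral>\<theta>. (prior S \<theta>)\<^sup>2 / importance S \<theta> *
     measure (pair_law S \<theta>) {(yl, y) \<in> space (pair_law S \<theta>). yl \<notin> Omega S \<and> y \<in> Omega S} \<partial>par_space S)"

definition T_lo :: "('t, 'y) mf_model \<Rightarrow> real" where
  "T_lo S = (\<integral>\<theta>. (\<integral>(yl, y). cost_lo S \<theta> yl \<partial>pair_law S \<theta>) * importance S \<theta> \<partial>par_space S)"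

definition T_hip :: "('t, 'y) mf_model \<Rightarrow> real" where
  "T_hip S = (\<integral>\<theta>. (\<integral>(yl, y). cost_hi S \<theta> yl y * indicator (Omega S) yl \<partial>pair_law S \<theta>)
     * importance S \<theta> \<partial>par_space S)"

definition T_hin :: "('t, 'y) mf_model \<Rightarrow> real" where
  "T_hin S = (\<integral>\<theta>. (\<integral>(yl, y). cost_hi S \<theta> yl y * indicator (- Omega S) yl \<partial>pair_law S \<theta>)
     * importance S \<theta> \<partial>par_space S)"

text \<open>
  The final group of assumptions says that the coefficients are finite, as is implicit in the
  definition of \<open>\<phi>\<close>; the finiteness of \<open>W_fn\<close> follows from that of \<open>W\<close>. Only finiteness of
  \<open>E\<^sub>\<theta>\<close> for almost every \<open>\<theta>\<close> with \<open>importance S \<theta> > 0\<close> is needed, so the costs are treated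
  with nonnegative integrals.
\<close>

locale mf_setting =
  fixes S :: "('t, 'y) mf_model"
  assumes par_sigma_finite: "sigma_finite_measure (par_space S)"
    and data_sigma_finite: "sigma_finite_measure (data_space S)"
    and prior_measurable: "prior S \<in> borel_measurable (par_space S)"
    and prior_nonneg: "\<And>\<theta>. \<theta> \<in> space (par_space S) \<Longrightarrow> 0 \<le> prior S \<theta>"
    and prior_total: "(\<integral>\<^sup>+\<theta>. ennreal (prior S \<theta>) \<partial>par_space S) = 1"
    and hifi_measurable:
      "(\<lambda>(\<theta>, y). hifi S \<theta> y) \<in> borel_measurable (par_space S \<Otimes>\<^sub>M data_space S)"
    and hifi_nonneg: "\<And>\<theta> y. \<theta> \<in> space (par_space S) \<Longrightarrow> y \<in> space (data_space S) \<Longrightarrow> 0 \<le> hifi S \<theta> y"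
    and hifi_total: "\<And>\<theta>. \<theta> \<in> space (par_space S) \<Longrightarrow> (\<integral>\<^sup>+y. ennreal (hifi S \<theta> y) \<partial>data_space S) = 1"
    and lofi_measurable:
      "(\<lambda>(\<theta>, y). lofi S \<theta> y) \<in> borel_measurable (par_space S \<Otimes>\<^sub>M data_space S)"
    and lofi_nonneg: "\<And>\<theta> y. \<theta> \<in> space (par_space S) \<Longrightarrow> y \<in> space (data_space S) \<Longrightarrow> 0 \<le> lofi S \<theta> y"
    and lofi_total: "\<And>\<theta>. \<theta> \<in> space (par_space S) \<Longrightarrow> (\<integral>\<^sup>+y. ennreal (lofi S \<theta> y) \<partial>data_space S) = 1"
    and coupling_measurable:
      "(\<lambda>(\<theta>, yl, y). coupling S \<theta> yl y)
         \<in> borel_measurable (par_space S \<Otimes>\<^sub>M data_space S \<Otimes>\<^sub>M data_space S)"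
    and coupling_nonneg:
      "\<And>\<theta> yl y. \<theta> \<in> space (par_space S) \<Longrightarrow> yl \<in> space (data_space S) \<Longrightarrow> y \<in> space (data_space S)
         \<Longrightarrow> 0 \<le> coupling S \<theta> yl y"
    and coupling_lofi:
      "\<And>\<theta>. \<theta> \<in> space (par_space S) \<Longrightarrow>
         AE yl in data_space S. (\<integral>\<^sup>+y. ennreal (coupling S \<theta> yl y) \<partial>data_space S) = ennreal (lofi S \<theta> yl)"
    and coupling_hifi:
      "\<And>\<theta>. \<theta> \<in> space (par_space S) \<Longrightarrow>
         AE y in data_space S. (\<integral>\<^sup>+yl. ennreal (coupling S \<theta> yl y) \<partial>data_space S) = ennreal (hifi S \<theta> y)"
    and metric: "Metric_space (space (data_space S)) (metric S)"
    and y_obs_in: "y_obs S \<in> space (data_space S)"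
    and eps_pos: "0 < eps S"
    and Omega_measurable: "Omega S \<in> sets (data_space S)"
    and importance_integrable: "integrable (par_space S) (importance S)"
    and importance_nonneg: "\<And>\<theta>. \<theta> \<in> space (par_space S) \<Longrightarrow> 0 \<le> importance S \<theta>"
    and importance_pos:
      "\<And>\<theta>. \<theta> \<in> space (par_space S) \<Longrightarrow> 0 < prior S \<theta> \<Longrightarrow> 0 < importance S \<theta>"
    and cost_lo_measurable:
      "(\<lambda>(\<theta>, yl). cost_lo S \<theta> yl) \<in> borel_measurable (par_space S \<Otimes>\<^sub>M data_space S)"
    and cost_lo_pos:
      "\<And>\<theta> yl. \<theta> \<in> space (par_space S) \<Longrightarrow> yl \<in> space (data_space S) \<Longrightarrow> 0 < cost_lo S \<theta> yl"
    and cost_hi_measurable: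
      "(\<lambda>(\<theta>, yl, y). cost_hi S \<theta> yl y)
         \<in> borel_measurable (par_space S \<Otimes>\<^sub>M data_space S \<Otimes>\<^sub>M data_space S)"
    and cost_hi_pos:
      "\<And>\<theta> yl y. \<theta> \<in> space (par_space S) \<Longrightarrow> yl \<in> space (data_space S) \<Longrightarrow> y \<in> space (data_space S)
         \<Longrightarrow> 0 < cost_hi S \<theta> yl y"
    and W_finite:
      "integrable (par_space S) (\<lambda>\<theta>. (prior S \<theta>)\<^sup>2 / importance S \<theta> *
         measure (pair_law S \<theta>) {(yl, y) \<in> space (pair_law S \<theta>). y \<in> Omega S})"
    and W_fp_finite:
      "integrable (par_space S) (\<lambda>\<theta>. (prior S \<theta>)\<^sup>2 / importance S \<theta> *
         measure (pair_law S \<theta>) {(yl, y) \<in> space (pair_law S \<theta>). yl \<in> Omega S \<and> y \<notin> Omega S})"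
    and T_lo_finite:
      "(\<integral>\<^sup>+\<theta>. (\<integral>\<^sup>+(yl, y). ennreal (cost_lo S \<theta> yl) \<partial>pair_law S \<theta>)
         * ennreal (importance S \<theta>) \<partial>par_space S) < \<infinity>"
    and T_hi_finite:
      "(\<integral>\<^sup>+\<theta>. (\<integral>\<^sup>+(yl, y). ennreal (cost_hi S \<theta> yl y) \<partial>pair_law S \<theta>)
         * ennreal (importance S \<theta>) \<partial>par_space S) < \<infinity>"

definition phi :: "('t, 'y) mf_model \<Rightarrow> real \<times> real \<Rightarrow> real" where
  "phi S = (\<lambda>(\<eta>1, \<eta>2). (W S + (1 / \<eta>1 - 1) * W_fp S + (1 / \<eta>2 - 1) * W_fn S)
                      * (T_lo S + \<eta>1 * T_hip S + \<eta>2 * T_hin S))"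

definition phi_bar :: "('t, 'y) mf_model \<Rightarrow> real" where
  "phi_bar S = (sqrt ((W S - W_fp S - W_fn S) * T_lo S) + sqrt (W_fp S * T_hip S)
                + sqrt (W_fn S * T_hin S))\<^sup>2"

definition eta_bar :: "('t, 'y) mf_model \<Rightarrow> real \<times> real" where
  "eta_bar S = (sqrt (T_lo S / (W S - W_fp S - W_fn S) * (W_fp S / T_hip S)),
                sqrt (T_lo S / (W S - W_fp S - W_fn S) * (W_fn S / T_hin S)))"

definition H_box :: "real \<Rightarrow> real \<Rightarrow> (real \<times> real) set" where
  "H_box \<rho>1 \<rho>2 = {\<rho>1..1} \<times> {\<rho>2..1}"

text \<open>
  The denominators below need not be positive. When one is not, the square root is read as
  \<open>+\<infinity>\<close>, so that the minimum with \<open>1\<close> is \<open>1\<close>: \<open>\<phi>\<close> is then nonincreasing along the edge.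
  (Literal use of \<open>x / 0 = 0\<close> and \<open>sqrt (- x) = - sqrt x\<close> would select the other end.)
  The other divisor, \<open>T_hip\<close> or \<open>T_hin\<close>, vanishes only together with \<open>W_fp\<close> or \<open>W_fn\<close>,
  and then \<open>\<phi>\<close> does not depend on the variable concerned.
\<close>

definition eta1 :: "('t, 'y) mf_model \<Rightarrow> real \<Rightarrow> real \<Rightarrow> real" where
  "eta1 S \<rho>1 x =
     (let D = W S - W_fp S - (1 - 1 / x) * W_fn S
      in max \<rho>1 (if D \<le> 0 then 1
                  else min 1 (sqrt ((T_lo S + T_hin S * x) / D * (W_fp S / T_hip S)))))"

definition eta2 :: "('t, 'y) mf_model \<Rightarrow> real \<Rightarrow> real \<Rightarrow> real" where
  "eta2 S \<rho>2 x =
     (let D = W S - (1 - 1 / x) * W_fp S - W_fn S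
      in max \<rho>2 (if D \<le> 0 then 1
                  else min 1 (sqrt ((T_lo S + T_hip S * x) / D * (W_fn S / T_hin S)))))"

definition edge_points :: "('t, 'y) mf_model \<Rightarrow> real \<Rightarrow> real \<Rightarrow> (real \<times> real) set" where
  "edge_points S \<rho>1 \<rho>2 =
     {(1, eta2 S \<rho>2 1), (eta1 S \<rho>1 1, 1), (\<rho>1, eta2 S \<rho>2 \<rho>1), (eta1 S \<rho>1 \<rho>2, \<rho>2)}"

text \<open>
  When \<open>W \<le> W_fp + W_fn\<close> the point \<open>eta_bar\<close> does not exist (its formula is meaningless), so
  the second alternative applies.
\<close>

definition bar_in_H :: "('t, 'y) mf_model \<Rightarrow> real \<Rightarrow> real \<Rightarrow> bool" where
  "bar_in_H S \<rho>1 \<rho>2 \<longleftrightarrow> W S > W_fp S + W_fn S \<and> eta_bar S \<in> H_box \<rho>1 \<rho>2"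

definition phi_star :: "('t, 'y) mf_model \<Rightarrow> real \<Rightarrow> real \<Rightarrow> real" where
  "phi_star S \<rho>1 \<rho>2 =
     (if bar_in_H S \<rho>1 \<rho>2 then phi_bar S else Min (phi S ` edge_points S \<rho>1 \<rho>2))"

text \<open>
  The possible values of the argument associated with \<open>phi_star\<close>: there is more than one if
  several of the four edge values tie.
\<close>

definition eta_star :: "('t, 'y) mf_model \<Rightarrow> real \<Rightarrow> real \<Rightarrow> (real \<times> real) set" where
  "eta_star S \<rho>1 \<rho>2 =
     (if bar_in_H S \<rho>1 \<rho>2 then {eta_bar S}
      else {\<eta> \<in> edge_points S \<rho>1 \<rho>2. phi S \<eta> = phi_star S \<rho>1 \<rho>2})"

end

theory Submission
  imports Defs
begin

text \<open>
  With \<open>E = W - W_fp - W_fn\<close>, the objective is \<open>(E + p / x + n / y) (c + a x + b y)\<close>. For \<open>E > 0\<close>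
  its distance to the Cauchy-Schwarz bound is an explicit sum of squares, which settles the
  unconstrained problem. In each variable separately it has the form \<open>u t + v / t + const\<close>, so
  the clamped stationary point minimises it on an interval. At an interior minimiser both
  stationarity equations hold; \<open>y\<close> times the first plus \<open>x\<close> times the second gives
  \<open>c (p y + n x) = E x y (a x + b y)\<close>, which rules out \<open>E \<le> 0\<close>, and for \<open>E > 0\<close> the two
  equations leave only the unconstrained minimiser. So, unless that point lies in the box, the
  minimum over the box is attained on an edge.
\<close>

section \<open>One variable at a time\<close>

text \<open>Up to constants the function is \<open>D * b * y + N * K / y\<close>, so its increment
  from \<open>y0\<close> to \<open>y\<close> factors as
  \<open>(y - y0) * (D * b - N * K / (y * y0))\<close>. Clamping makes the two factors agree in
  sign. For \<open>D \<le> 0\<close> the second is nonpositive and \<open>y0 = 1\<close> is the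
  right end.\<close>

lemma edge_minimum:
  fixes D K N b r y :: real
  assumes "0 < K" "0 \<le> N" "0 \<le> b" "0 < N \<longrightarrow> 0 < b" "0 < r" "r \<le> y" "y \<le> 1"
  defines "y0 \<equiv> max r (if D \<le> 0 then 1 else min 1 (sqrt (K / D * (N / b))))"
  shows "(D + N / y0) * (K + b * y0) \<le> (D + N / y) * (K + b * y)"
proof -
  have y: "0 < y" using assms by simp
  have y0: "0 < y0" using assms(5) unfolding y0_def by linarith
  have "0 \<le> (y - y0) * (D * b - N * K / (y * y0))"
  proof (cases "D \<le> 0")
    case True
    then have [simp]: "y0 = 1" using assms by (simp add: y0_def)
    have "D * b \<le> 0" using True assms by (simp add: mult_nonpos_nonneg)
    moreover have "0 \<le> N * K / y" using assms y by simp
    ultimately have "D * b - N * K / (y * y0) \<le> 0" by (simp del: zero_le_divide_iff)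
    then show ?thesis using assms(7) by (simp add: mult_nonpos_nonpos)
  next
    case False
    show ?thesis
    proof (cases "b = 0")
      case True
      \<comment> \<open>Here \<open>N = 0\<close> as well, so the product is zero wherever
        \<open>y0\<close> lies.\<close>
      then show ?thesis using assms by auto
    next
      case nz: False
      \<comment> \<open>The unclamped stationary point. Substituting
        \<open>N * K = D * b * s\<^sup>2\<close> reduces the sign of the second factor to that of
        \<open>y * y0 - s\<^sup>2\<close>. The cases are \<open>s\<close> left of, right of or
        inside the interval.\<close>
      define s where "s = sqrt (K / D * (N / b))"
      have u: "0 < D * b" using False nz assms by simp
      have s0: "0 \<le> s" using False assms by (simp add: s_def)
      have "s\<^sup>2 = K / D * (N / b)" using False assms by (simp add: s_def)
      then have v: "N * K = D * b * s\<^sup>2" using False nz by (simp add: field_simps)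
      have factor: "D * b - N * K / (y * y0) = D * b * (y * y0 - s\<^sup>2) / (y * y0)"
        unfolding v using y y0 by (simp add: field_simps)
      have "0 \<le> (y - y0) * (y * y0 - s\<^sup>2)"
      proof (cases "s \<le> r")
        case True
        then have [simp]: "y0 = r" using False assms by (auto simp: y0_def s_def)
        have "s\<^sup>2 \<le> y * r" unfolding power2_eq_square
          using True s0 assms by (intro mult_mono) auto
        then show ?thesis using assms by simp
      next
        case sr: False
        show ?thesis
        proof (cases "1 \<le> s")
          case True
          then have [simp]: "y0 = 1" using False assms by (auto simp: y0_def s_def)
          have "y * 1 \<le> s * s" using True assms by (intro mult_mono) auto
          then show ?thesis using assms by (auto simp: power2_eq_square intro!: mult_nonpos_nonpos)
        next
          case s1: False
          then have [simp]: "y0 = s" using False sr by (auto simp: y0_def s_def)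
          have "(y - s) * (y * s - s\<^sup>2) = s * (y - s)\<^sup>2" by (simp add: power2_eq_square algebra_simps)
          then show ?thesis using s0 by simp
        qed
      qed
      then have "0 \<le> D * b * ((y - y0) * (y * y0 - s\<^sup>2)) / (y * y0)"
        using u y y0 by simp
      then show ?thesis unfolding factor by (simp add: mult.assoc mult.left_commute)
    qed
  qed
  also have "(y - y0) * (D * b - N * K / (y * y0))
      = (D + N / y) * (K + b * y) - (D + N / y0) * (K + b * y0)"
    using y y0 by (simp add: field_simps)
  finally show ?thesis by simp
qed

lemma stationary_point:
  fixes D K N b t d :: real
  assumes "0 < t" "0 < d"
    and min: "\<And>s. 0 < s \<Longrightarrow> \<bar>t - s\<bar> < d \<Longrightarrow> (D + N / t) * (K + b * t) \<le> (D + N / s) * (K + b * s)"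
  shows "b * t\<^sup>2 * D = N * K"
proof -
  have "((\<lambda>s. (D + N / s) * (K + b * s)) has_real_derivative D * b - N * K / t\<^sup>2) (at t)"
  proof -
    have "((\<lambda>s. (D + N / s) * (K + b * s)) has_real_derivative
        (D + N / t) * b + (- N / (t * t)) * (K + b * t)) (at t)"
      using assms(1) by (auto intro!: derivative_eq_intros)
    moreover have "(D + N / t) * b + (- N / (t * t)) * (K + b * t) = D * b - N * K / t\<^sup>2"
      using assms(1) by (simp add: field_simps power2_eq_square)
    ultimately show ?thesis by simp
  qed
  \<comment> \<open>The radius is cut down to \<open>t\<close> so that \<open>s\<close> stays
    positive, where \<open>min\<close> applies.\<close>
  moreover have "0 < min d t" using assms by simp
  moreover have "\<forall>s. \<bar>t - s\<bar> < min d t \<longrightarrow> (D + N / t) * (K + b * t) \<le> (D + N / s) * (K + b * s)"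
    using min by auto
  ultimately have "D * b - N * K / t\<^sup>2 = 0" by (rule DERIV_local_min)
  then show ?thesis using assms(1) by (simp add: field_simps)
qed

section \<open>The two-variable problem\<close>

text \<open>The analytic problem without the measure theory: \<open>E + p + n\<close> stands for
  \<open>W\<close>, and \<open>c\<close>, \<open>a\<close>, \<open>b\<close> for the mean costs.
  \<open>E\<close> may have either sign. By the last two assumptions \<open>p / a\<close> and
  \<open>n / b\<close> have a zero denominator only if the numerator is zero too.\<close>

locale efficiency =
  fixes E p n c a b :: real
  assumes c_pos: "0 < c" and nonneg: "0 \<le> p" "0 \<le> n" "0 \<le> a" "0 \<le> b" "0 \<le> E + p + n"
    and a_pos: "0 < p \<Longrightarrow> 0 < a" and b_pos: "0 < n \<Longrightarrow> 0 < b"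
begin

definition F :: "real \<Rightarrow> real \<Rightarrow> real" where
  "F x y = (E + p / x + n / y) * (c + a * x + b * y)"

text \<open>Both clamps have the form of \<open>y0\<close> in \<open>edge_minimum\<close>; with the
  coefficients of the model they become \<open>eta1\<close> and \<open>eta2\<close>.\<close>

definition clamp1 :: "real \<Rightarrow> real \<Rightarrow> real" where
  "clamp1 r y = max r (if E + n / y \<le> 0 then 1
      else min 1 (sqrt ((c + b * y) / (E + n / y) * (p / a))))"

definition clamp2 :: "real \<Rightarrow> real \<Rightarrow> real" where
  "clamp2 r x = max r (if E + p / x \<le> 0 then 1
      else min 1 (sqrt ((c + a * x) / (E + p / x) * (n / b))))"

text \<open>With \<open>y\<close> frozen, \<open>F\<close> is the function of
  \<open>edge_minimum\<close> for \<open>D = E + n / y\<close> and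
  \<open>K = c + b * y\<close>.\<close>

lemma F_clamp1_le:
  assumes "0 < r" "r \<le> x" "x \<le> 1" "0 < y"
  shows "F (clamp1 r y) y \<le> F x y"
proof -
  have F: "F z y = (E + n / y + p / z) * (c + b * y + a * z)" for z
    by (simp add: F_def algebra_simps)
  show ?thesis
    using edge_minimum[of "c + b * y" p a r x "E + n / y", folded clamp1_def] assms c_pos nonneg a_pos
    by (simp add: F add_pos_nonneg)
qed

lemma F_clamp2_le:
  assumes "0 < r" "r \<le> y" "y \<le> 1" "0 < x"
  shows "F x (clamp2 r x) \<le> F x y"
proof -
  have F: "F x z = (E + p / x + n / z) * (c + a * x + b * z)" for z
    by (simp add: F_def algebra_simps)
  show ?thesis
    using edge_minimum[of "c + a * x" n b r y "E + p / x", folded clamp2_def] assms c_pos nonneg b_pos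
    by (simp add: F add_pos_nonneg)
qed

section \<open>Stationarity equations and their consequences\<close>

lemma stationary1:
  assumes "0 < x" "0 < d" "\<And>s. 0 < s \<Longrightarrow> \<bar>x - s\<bar> < d \<Longrightarrow> F x y \<le> F s y"
  shows "a * x\<^sup>2 * (E + n / y) = p * (c + b * y)"
proof (rule stationary_point[OF assms(1,2)])
  fix s :: real assume "0 < s" "\<bar>x - s\<bar> < d"
  from assms(3)[OF this]
  show "(E + n / y + p / x) * (c + b * y + a * x) \<le> (E + n / y + p / s) * (c + b * y + a * s)"
    by (simp add: F_def algebra_simps)
qed

lemma stationary2:
  assumes "0 < y" "0 < d" "\<And>s. 0 < s \<Longrightarrow> \<bar>y - s\<bar> < d \<Longrightarrow> F x y \<le> F x s"
  shows "b * y\<^sup>2 * (E + p / x) = n * (c + a * x)"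
proof (rule stationary_point[OF assms(1,2)])
  fix s :: real assume "0 < s" "\<bar>y - s\<bar> < d"
  from assms(3)[OF this]
  show "(E + p / x + n / y) * (c + a * x + b * y) \<le> (E + p / x + n / s) * (c + a * x + b * s)"
    by (simp add: F_def algebra_simps)
qed

context
  fixes x y :: real
  assumes x: "0 < x" and y: "0 < y"
    and s1: "a * x\<^sup>2 * (E + n / y) = p * (c + b * y)"
    and s2: "b * y\<^sup>2 * (E + p / x) = n * (c + a * x)"
begin

text \<open>Denominator-free forms, from which the identities below follow by polynomial
  algebra.\<close>

lemma stationary_cleared:
  "a * x\<^sup>2 * (E * y + n) = p * (c + b * y) * y"
  "b * y\<^sup>2 * (E * x + p) = n * (c + a * x) * x"
proof -
  have "a * x\<^sup>2 * (E * y + n) = a * x\<^sup>2 * (E + n / y) * y" using y by (simp add: field_simps)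
  then show "a * x\<^sup>2 * (E * y + n) = p * (c + b * y) * y" by (simp add: s1)
  have "b * y\<^sup>2 * (E * x + p) = b * y\<^sup>2 * (E + p / x) * x" using x by (simp add: field_simps)
  then show "b * y\<^sup>2 * (E * x + p) = n * (c + a * x) * x" by (simp add: s2)
qed

lemma stationary_E_pos:
  assumes "0 < p + n"
  shows "0 < E"
proof (rule ccontr)
  assume "\<not> 0 < E"
  then have "E * (x * y * (a * x + b * y)) \<le> 0"
    using x y nonneg by (intro mult_nonpos_nonneg) auto
  \<comment> \<open>The sum of the two cleared equations; the terms \<open>n * a * x\<^sup>2\<close>
    and \<open>p * b * y\<^sup>2\<close> cancel.\<close>
  moreover have "c * (p * y + n * x) = E * (x * y * (a * x + b * y))"
    using stationary_cleared by (simp add: algebra_simps power2_eq_square)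
  moreover have "0 < p * y + n * x"
    using assms x y nonneg by (cases "p = 0") (auto intro!: add_pos_nonneg)
  then have "0 < c * (p * y + n * x)" using c_pos by simp
  ultimately show False by linarith
qed

text \<open>The defects \<open>u\<close> and \<open>v\<close> vanish exactly at the claimed values.
  The equations give two linear relations between them, and eliminating \<open>v\<close> leaves
  \<open>u\<close> times a positive number equal to zero.\<close>

lemma stationary_unique:
  assumes "0 < p" "0 < n"
  shows "x = sqrt (c / E * (p / a))" "y = sqrt (c / E * (n / b))"
proof -
  have E: "0 < E" using stationary_E_pos assms by simp
  have a: "0 < a" and b: "0 < b" using a_pos b_pos assms by auto
  define u where "u = a * x\<^sup>2 * E - p * c"
  define v where "v = b * y\<^sup>2 * E - n * c"
  have 1: "u * y = p * b * y\<^sup>2 - n * a * x\<^sup>2" and 2: "v * x = n * a * x\<^sup>2 - p * b * y\<^sup>2"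
    using stationary_cleared by (simp_all add: u_def v_def algebra_simps power2_eq_square)
  have vx: "v * x = - (u * y)" using 1 2 by simp
  \<comment> \<open>Replace \<open>E * b * y\<^sup>2\<close> by \<open>v + n * c\<close> and
    \<open>E * a * x\<^sup>2\<close> by \<open>u + p * c\<close>; the multiples of
    \<open>p * n * c\<close> cancel.\<close>
  have "E * (u * y) = p * v - n * u"
    unfolding 1 by (simp add: u_def v_def algebra_simps)
  then have "E * (u * y) * x = (p * v - n * u) * x" by simp
  then have "E * (u * y) * x = p * (v * x) - n * u * x" by (simp add: algebra_simps)
  then have "u * (E * y * x + p * y + n * x) = 0" unfolding vx by (simp add: algebra_simps)
  moreover have "0 < E * y * x + p * y + n * x"
    using E x y assms by (intro add_pos_pos mult_pos_pos)
  ultimately have u0: "u = 0" by simp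
  with vx x have v0: "v = 0" by simp
  have "x\<^sup>2 = c / E * (p / a)" using u0 E a by (simp add: u_def field_simps)
  with x show "x = sqrt (c / E * (p / a))" by (simp add: real_sqrt_unique)
  have "y\<^sup>2 = c / E * (n / b)" using v0 E b by (simp add: v_def field_simps)
  with y show "y = sqrt (c / E * (n / b))" by (simp add: real_sqrt_unique)
qed

end

section \<open>The unconstrained problem\<close>

lemma global_minimiser_stationary:
  assumes "0 < x" "0 < y" and min: "\<And>s t. 0 < s \<Longrightarrow> 0 < t \<Longrightarrow> F x y \<le> F s t"
  shows "a * x\<^sup>2 * (E + n / y) = p * (c + b * y)" "b * y\<^sup>2 * (E + p / x) = n * (c + a * x)"
  using stationary1[of x 1 y] stationary2[of y 1 x] assms by simp_all

text \<open>Cauchy-Schwarz for the vectors with entries the square roots of \<open>E\<close>,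
  \<open>p / x\<close>, \<open>n / y\<close> and of \<open>c\<close>, \<open>a * x\<close>,
  \<open>b * y\<close>: their inner product does not depend on \<open>x\<close> and
  \<open>y\<close>.\<close>

lemma cauchy_schwarz_bound:
  assumes E: "0 < E" and p: "0 < p" and n: "0 < n"
  defines "X \<equiv> sqrt (c / E * (p / a))" and "Y \<equiv> sqrt (c / E * (n / b))"
    and "m \<equiv> (sqrt (E * c) + sqrt (p * a) + sqrt (n * b))\<^sup>2"
  shows "0 < X" "0 < Y" "F X Y = m" "\<And>x y. 0 < x \<Longrightarrow> 0 < y \<Longrightarrow> m \<le> F x y"
proof -
  have a: "0 < a" and b: "0 < b" using a_pos b_pos p n by auto
  \<comment> \<open>Naming the roots turns the gap into an identity of rational functions.\<close>
  define e k q g r h where "e = sqrt E" and "k = sqrt c" and "q = sqrt p" and "g = sqrt a"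
    and "r = sqrt n" and "h = sqrt b"
  note defs = e_def k_def q_def g_def r_def h_def
  have pos: "0 < e" "0 < k" "0 < q" "0 < g" "0 < r" "0 < h"
    using E c_pos p a n b by (simp_all add: defs)
  have sq: "E = e\<^sup>2" "c = k\<^sup>2" "p = q\<^sup>2" "a = g\<^sup>2" "n = r\<^sup>2" "b = h\<^sup>2"
    using E c_pos p a n b by (simp_all add: defs)
  have X: "X = k * q / (e * g)" and Y: "Y = k * r / (e * h)"
    by (simp_all add: X_def Y_def defs real_sqrt_mult real_sqrt_divide)
  have m: "m = (e * k + q * g + r * h)\<^sup>2"
    by (simp add: m_def defs real_sqrt_mult)
  \<comment> \<open>Lagrange's identity: one square for each pair of entries. All three vanish at
    \<open>X\<close>, \<open>Y\<close>.\<close>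
  have gap: "F x y - m = (e * g * x - q * k)\<^sup>2 / x + (e * h * y - r * k)\<^sup>2 / y
      + (q * h * y - r * g * x)\<^sup>2 / (x * y)" if "0 < x" "0 < y" for x y
    using that unfolding F_def m unfolding sq by (simp add: field_simps power2_eq_square)
  show X0: "0 < X" and Y0: "0 < Y" using pos by (simp_all add: X Y)
  have "e * g * X = q * k" "e * h * Y = r * k" "q * h * Y = r * g * X"
    using pos by (simp_all add: X Y)
  then show "F X Y = m" using gap[OF X0 Y0] by simp
  show "m \<le> F x y" if "0 < x" "0 < y" for x y
  proof -
    have "0 \<le> F x y - m" unfolding gap[OF that] using that by simp
    then show ?thesis by simp
  qed
qed

section \<open>The minimum over the box\<close>

lemma continuous_on_F:
  assumes "0 < r1" "0 < r2"
  shows "continuous_on ({r1..1} \<times> {r2..1}) (\<lambda>(x, y). F x y)"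
  unfolding F_def case_prod_beta using assms
  by (auto intro!: continuous_intros)

text \<open>Compactness yields a minimiser. It lies on an edge, or can be slid to one when
  \<open>p = 0\<close> or \<open>n = 0\<close>, or is an interior stationary point, which
  \<open>outside\<close> forbids. Clamping along that edge then gives one of the four
  candidates.\<close>

lemma edge_minimum_box:
  assumes r: "0 < r1" "r1 < 1" "0 < r2" "r2 < 1"
    and outside: "\<not> (0 < E \<and> sqrt (c / E * (p / a)) \<in> {r1..1} \<and> sqrt (c / E * (n / b)) \<in> {r2..1})"
  obtains x y where "(x, y) \<in> {(1, clamp2 r2 1), (clamp1 r1 1, 1), (r1, clamp2 r2 r1), (clamp1 r1 r2, r2)}"
    "\<And>s t. s \<in> {r1..1} \<Longrightarrow> t \<in> {r2..1} \<Longrightarrow> F x y \<le> F s t"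
proof -
  have "\<exists>z \<in> {r1..1} \<times> {r2..1}. \<forall>w \<in> {r1..1} \<times> {r2..1}. (\<lambda>(x, y). F x y) z \<le> (\<lambda>(x, y). F x y) w"
    using r continuous_on_F by (intro continuous_attains_inf compact_Times) auto
  then obtain x y where x: "r1 \<le> x" "x \<le> 1" and y: "r2 \<le> y" "y \<le> 1"
    and min: "\<And>s t. s \<in> {r1..1} \<Longrightarrow> t \<in> {r2..1} \<Longrightarrow> F x y \<le> F s t"
    by fastforce
  have pos: "0 < x" "0 < y" using x y r by auto
  have "\<exists>x' y'. (x' \<in> {r1, 1} \<and> r2 \<le> y' \<and> y' \<le> 1 \<or> r1 \<le> x' \<and> x' \<le> 1 \<and> y' \<in> {r2, 1}) \<and> F x' y' \<le> F x y"
  proof (cases "x \<in> {r1, 1} \<or> y \<in> {r2, 1}")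
    case True
    then show ?thesis using x y by auto
  next
    case False
    then have int: "r1 < x" "x < 1" "r2 < y" "y < 1" using x y by auto
    show ?thesis
    proof (cases "p = 0")
      case True
      \<comment> \<open>With \<open>p = 0\<close> the first factor of \<open>F\<close> does not
        depend on \<open>x\<close>, and it is at least \<open>E + n \<ge> 0\<close> since
        \<open>y \<le> 1\<close>. So \<open>F\<close> is nondecreasing in \<open>x\<close> and the
        left edge is no worse.\<close>
      have "n \<le> n / y" using nonneg y pos by (simp add: pos_le_divide_eq mult_left_le)
      then have "0 \<le> E + n / y" using nonneg True by linarith
      then have "F r1 y \<le> F x y"
        unfolding F_def using True x nonneg by (auto intro!: mult_left_mono)
      then show ?thesis using y by blast
    next
      case p: False
      show ?thesis
      proof (cases "n = 0")
        case True
        have "p \<le> p / x" using nonneg x pos by (simp add: pos_le_divide_eq mult_left_le)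
        then have "0 \<le> E + p / x" using nonneg True by linarith
        then have "F x r2 \<le> F x y"
          unfolding F_def using True y nonneg by (auto intro!: mult_left_mono)
        then show ?thesis using x by blast
      next
        case n: False
        have 1: "a * x\<^sup>2 * (E + n / y) = p * (c + b * y)"
        \<comment> \<open>The radius is the distance to the nearer vertical side, so the competitors
          stay in the box.\<close>
        proof (rule stationary1[OF pos(1), of "min (x - r1) (1 - x)"])
          fix s assume "\<bar>x - s\<bar> < min (x - r1) (1 - x)"
          then show "F x y \<le> F s y" using y by (intro min) (auto simp: abs_less_iff)
        qed (use int in simp)
        have 2: "b * y\<^sup>2 * (E + p / x) = n * (c + a * x)"
        proof (rule stationary2[OF pos(2), of "min (y - r2) (1 - y)"])
          fix s assume "\<bar>y - s\<bar> < min (y - r2) (1 - y)"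
          then show "F x y \<le> F x s" using x by (intro min) (auto simp: abs_less_iff)
        qed (use int in simp)
        have pn: "0 < p" "0 < n" using p n nonneg by auto
        have "0 < E" using stationary_E_pos[OF pos 1 2] pn by simp
        moreover note stationary_unique[OF pos 1 2 pn]
        ultimately have False using outside x y by auto
        then show ?thesis ..
      qed
    qed
  qed
  then obtain x' y' where
    cases: "x' \<in> {r1, 1} \<and> r2 \<le> y' \<and> y' \<le> 1 \<or> r1 \<le> x' \<and> x' \<le> 1 \<and> y' \<in> {r2, 1}"
    and le: "F x' y' \<le> F x y" by blast
  have le2: "F x' (clamp2 r2 x') \<le> F x y" if "x' \<in> {r1, 1}" "r2 \<le> y'" "y' \<le> 1"
    using F_clamp2_le[of r2 y' x'] that r le by force
  have le1: "F (clamp1 r1 y') y' \<le> F x y" if "y' \<in> {r2, 1}" "r1 \<le> x'" "x' \<le> 1"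
    using F_clamp1_le[of r1 x' y'] that r le by force
  from cases show thesis
  proof
    assume *: "x' \<in> {r1, 1} \<and> r2 \<le> y' \<and> y' \<le> 1"
    show thesis
    proof (rule that)
      show "F x' (clamp2 r2 x') \<le> F s t" if "s \<in> {r1..1}" "t \<in> {r2..1}" for s t
        using le2 min[OF that] * by (meson order_trans)
    qed (use * in auto)
  next
    assume *: "r1 \<le> x' \<and> x' \<le> 1 \<and> y' \<in> {r2, 1}"
    show thesis
    proof (rule that)
      show "F (clamp1 r1 y') y' \<le> F s t" if "s \<in> {r1..1}" "t \<in> {r2..1}" for s t
        using le1 min[OF that] * by (meson order_trans)
    qed (use * in auto)
  qed
qed

lemma clamp_bounds:
  assumes "0 < r" "r < 1"
  shows "clamp1 r y \<in> {r..1}" "clamp2 r x \<in> {r..1}"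
  using assms by (auto simp: clamp1_def clamp2_def)

end

section \<open>The coefficients\<close>

context mf_setting
begin

section \<open>The law of the pair and vanishing mean costs\<close>

interpretation par: sigma_finite_measure "par_space S"
  by (rule par_sigma_finite)

interpretation data: sigma_finite_measure "data_space S"
  by (rule data_sigma_finite)

interpretation pair: pair_sigma_finite "data_space S" "data_space S" ..

declare prior_measurable[measurable] coupling_measurable[measurable] cost_lo_measurable[measurable]
  cost_hi_measurable[measurable] Omega_measurable[measurable]
  importance_integrable[THEN borel_measurable_integrable, measurable]

lemma space_pair_law: "space (pair_law S \<theta>) = space (data_space S) \<times> space (data_space S)"
  by (simp add: pair_law_def space_pair_measure)

lemma sets_pair_law [measurable_cong]: "sets (pair_law S \<theta>) = sets (data_space S \<Otimes>\<^sub>M data_space S)"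
  by (simp add: pair_law_def)

lemma nn_integral_pair_law:
  assumes [measurable]: "\<theta> \<in> space (par_space S)"
    "h \<in> borel_measurable (data_space S \<Otimes>\<^sub>M data_space S)"
  shows "(\<integral>\<^sup>+z. h z \<partial>pair_law S \<theta>)
    = (\<integral>\<^sup>+z. (case z of (yl, y) \<Rightarrow> ennreal (coupling S \<theta> yl y)) * h z \<partial>(data_space S \<Otimes>\<^sub>M data_space S))"
  unfolding pair_law_def by (rule nn_integral_density) measurable

text \<open>By Tonelli, integrating over \<open>y\<close> first leaves the low-fidelity marginal,
  whose total mass is one.\<close>

lemma emeasure_pair_law_space:
  assumes \<theta>[measurable]: "\<theta> \<in> space (par_space S)"
  shows "emeasure (pair_law S \<theta>) (space (pair_law S \<theta>)) = 1"
proof -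
  have "emeasure (pair_law S \<theta>) (space (pair_law S \<theta>)) = (\<integral>\<^sup>+z. 1 \<partial>pair_law S \<theta>)"
    by simp
  also have "\<dots> = (\<integral>\<^sup>+z. (case z of (yl, y) \<Rightarrow> ennreal (coupling S \<theta> yl y)) \<partial>(data_space S \<Otimes>\<^sub>M data_space S))"
    by (subst nn_integral_pair_law) (use \<theta> in simp_all)
  also have "\<dots> = (\<integral>\<^sup>+yl. \<integral>\<^sup>+y. ennreal (coupling S \<theta> yl y) \<partial>data_space S \<partial>data_space S)"
    by (subst data.nn_integral_fst[symmetric]) simp_all
  also have "\<dots> = (\<integral>\<^sup>+yl. ennreal (lofi S \<theta> yl) \<partial>data_space S)"
    using coupling_lofi[OF \<theta>] by (rule nn_integral_cong_AE)
  also have "\<dots> = 1" using lofi_total[OF \<theta>] .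
  finally show ?thesis .
qed

text \<open>The measure itself varies with \<theta>. Moving its density into the integrand gives an
  integral over a fixed product measure, to which Tonelli measurability applies.\<close>

lemma nn_integral_pair_law_measurable:
  assumes [measurable]: "(\<lambda>(\<theta>, yl, y). h \<theta> yl y)
      \<in> borel_measurable (par_space S \<Otimes>\<^sub>M data_space S \<Otimes>\<^sub>M data_space S)"
  shows "(\<lambda>\<theta>. \<integral>\<^sup>+(yl, y). ennreal (h \<theta> yl y) \<partial>pair_law S \<theta>) \<in> borel_measurable (par_space S)"
proof -
  have [measurable]:
    "(\<lambda>x. coupling S (fst x) (fst (snd x)) (snd (snd x)))
      \<in> borel_measurable (par_space S \<Otimes>\<^sub>M data_space S \<Otimes>\<^sub>M data_space S)"
    "(\<lambda>x. h (fst x) (fst (snd x)) (snd (snd x)))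
      \<in> borel_measurable (par_space S \<Otimes>\<^sub>M data_space S \<Otimes>\<^sub>M data_space S)"
    using coupling_measurable assms by (simp_all add: case_prod_beta')
  have "(\<lambda>\<theta>. \<integral>\<^sup>+z. (case z of (yl, y) \<Rightarrow> ennreal (coupling S \<theta> yl y))
      * (case z of (yl, y) \<Rightarrow> ennreal (h \<theta> yl y)) \<partial>(data_space S \<Otimes>\<^sub>M data_space S))
      \<in> borel_measurable (par_space S)"
    unfolding case_prod_beta by measurable
  then show ?thesis
    by (rule measurable_cong[THEN iffD1, rotated]) (subst nn_integral_pair_law; simp)
qed

text \<open>The finiteness assumption excludes the junk value \<open>0\<close> of a divergent integral.\<close>

lemma mean_cost_eq_0D:
  assumes h[measurable]: "(\<lambda>(\<theta>, yl, y). h \<theta> yl y)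
      \<in> borel_measurable (par_space S \<Otimes>\<^sub>M data_space S \<Otimes>\<^sub>M data_space S)"
    and nonneg: "\<And>\<theta> yl y. \<theta> \<in> space (par_space S) \<Longrightarrow> yl \<in> space (data_space S)
      \<Longrightarrow> y \<in> space (data_space S) \<Longrightarrow> 0 \<le> h \<theta> yl y"
    and fin: "(\<integral>\<^sup>+\<theta>. (\<integral>\<^sup>+(yl, y). ennreal (h \<theta> yl y) \<partial>pair_law S \<theta>) * ennreal (importance S \<theta>) \<partial>par_space S) < \<infinity>"
    and zero: "(\<integral>\<theta>. (\<integral>(yl, y). h \<theta> yl y \<partial>pair_law S \<theta>) * importance S \<theta> \<partial>par_space S) = 0"
  shows "AE \<theta> in par_space S. 0 < importance S \<theta> \<longrightarrow> (AE (yl, y) in pair_law S \<theta>. h \<theta> yl y = 0)"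
proof -
  define J where "J \<theta> = (\<integral>\<^sup>+(yl, y). ennreal (h \<theta> yl y) \<partial>pair_law S \<theta>)" for \<theta>
  have J[measurable]: "J \<in> borel_measurable (par_space S)"
    using nn_integral_pair_law_measurable[OF h] unfolding J_def[abs_def] .
  have inner: "(\<integral>(yl, y). h \<theta> yl y \<partial>pair_law S \<theta>) = enn2real (J \<theta>)" if [measurable]: "\<theta> \<in> space (par_space S)" for \<theta>
  proof -
    have "AE z in pair_law S \<theta>. 0 \<le> (case z of (yl, y) \<Rightarrow> h \<theta> yl y)"
      using nonneg that by (intro AE_I2) (auto simp: space_pair_law)
    then show ?thesis
      unfolding J_def by (subst integral_eq_nn_integral) (simp_all add: case_prod_beta')
  qed
  \<comment> \<open>\<open>enn2real\<close> sends \<infinity> to 0. Almost everywhere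
    \<open>J\<close> can be infinite only where \<open>importance\<close> is zero, and there both
    products vanish.\<close>
  have fin_AE: "AE \<theta> in par_space S. J \<theta> * ennreal (importance S \<theta>) \<noteq> \<infinity>"
    using fin unfolding J_def[symmetric] by (intro nn_integral_PInf_AE) auto
  have "(\<integral>\<theta>. enn2real (J \<theta>) * importance S \<theta> \<partial>par_space S) = 0"
    using zero by (simp add: inner cong: Bochner_Integration.integral_cong)
  moreover have "(\<integral>\<theta>. enn2real (J \<theta>) * importance S \<theta> \<partial>par_space S)
      = enn2real (\<integral>\<^sup>+\<theta>. ennreal (enn2real (J \<theta>) * importance S \<theta>) \<partial>par_space S)"
    using importance_nonneg by (intro integral_eq_nn_integral AE_I2) auto
  moreover have "(\<integral>\<^sup>+\<theta>. ennreal (enn2real (J \<theta>) * importance S \<theta>) \<partial>par_space S)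
      = (\<integral>\<^sup>+\<theta>. J \<theta> * ennreal (importance S \<theta>) \<partial>par_space S)"
  proof (rule nn_integral_cong_AE)
    show "AE \<theta> in par_space S. ennreal (enn2real (J \<theta>) * importance S \<theta>) = J \<theta> * ennreal (importance S \<theta>)"
      using fin_AE
    proof (rule AE_mp, intro AE_I2 impI)
      fix \<theta> assume \<theta>: "\<theta> \<in> space (par_space S)" "J \<theta> * ennreal (importance S \<theta>) \<noteq> \<infinity>"
      then show "ennreal (enn2real (J \<theta>) * importance S \<theta>) = J \<theta> * ennreal (importance S \<theta>)"
        using importance_nonneg[OF \<theta>(1)]
        by (cases "J \<theta>"; cases "importance S \<theta> = 0") (auto simp: ennreal_mult ennreal_top_mult)
    qed
  qed
  ultimately have "(\<integral>\<^sup>+\<theta>. J \<theta> * ennreal (importance S \<theta>) \<partial>par_space S) = 0"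
    using fin by (auto simp: enn2real_eq_0_iff J_def)
  then have "AE \<theta> in par_space S. J \<theta> * ennreal (importance S \<theta>) = 0"
    by (subst (asm) nn_integral_0_iff_AE) auto
  then show ?thesis using AE_space
  proof eventually_elim
    case (elim \<theta>)
    note \<theta>[measurable] = elim(2)
    show ?case
    proof
      assume "0 < importance S \<theta>"
      with elim(1) have "J \<theta> = 0" by auto
      then have "AE z in pair_law S \<theta>. (case z of (yl, y) \<Rightarrow> ennreal (h \<theta> yl y)) = 0"
        unfolding J_def by (subst (asm) nn_integral_0_iff_AE) simp_all
      then show "AE (yl, y) in pair_law S \<theta>. h \<theta> yl y = 0"
        by (rule AE_mp, intro AE_I2 impI)
          (use nonneg[OF \<theta>] in \<open>force simp: space_pair_law ennreal_eq_0_iff\<close>)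
    qed
  qed
qed

text \<open>A zero mean would make a strictly positive cost vanish almost surely under a law of mass
  one wherever \<open>prior\<close> is positive, so \<open>prior\<close> would vanish almost
  everywhere, against its total mass.\<close>

lemma T_lo_pos: "0 < T_lo S"
proof (rule ccontr)
  assume "\<not> 0 < T_lo S"
  moreover have "0 \<le> T_lo S" unfolding T_lo_def
    by (intro Bochner_Integration.integral_nonneg mult_nonneg_nonneg importance_nonneg)
      (auto simp: space_pair_law less_imp_le cost_lo_pos)
  ultimately have "T_lo S = 0" by simp
  then have "AE \<theta> in par_space S. 0 < importance S \<theta>
      \<longrightarrow> (AE (yl, y) in pair_law S \<theta>. cost_lo S \<theta> yl = 0)"
    using T_lo_finite unfolding T_lo_def
    by (intro mean_cost_eq_0D) (auto simp: less_imp_le cost_lo_pos)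
  then have "AE \<theta> in par_space S. ennreal (prior S \<theta>) = 0"
  proof (rule AE_mp, intro AE_I2 impI)
    fix \<theta> assume \<theta>: "\<theta> \<in> space (par_space S)"
      and zero: "0 < importance S \<theta> \<longrightarrow> (AE (yl, y) in pair_law S \<theta>. cost_lo S \<theta> yl = 0)"
    have False if "0 < prior S \<theta>"
    proof -
      from zero importance_pos[OF \<theta> that]
      have "AE z in pair_law S \<theta>. (case z of (yl, y) \<Rightarrow> cost_lo S \<theta> yl = 0)" by simp
      then have "AE z in pair_law S \<theta>. \<not> True"
        by (rule AE_mp, intro AE_I2 impI) (use cost_lo_pos[OF \<theta>] in \<open>force simp: space_pair_law\<close>)
      then have "emeasure (pair_law S \<theta>) {z \<in> space (pair_law S \<theta>). True} = 0"
        by (rule emeasure_eq_0_AE)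
      then show False using emeasure_pair_law_space[OF \<theta>] by simp
    qed
    then show "ennreal (prior S \<theta>) = 0" by (force simp: ennreal_eq_0_iff)
  qed
  then have "(\<integral>\<^sup>+\<theta>. ennreal (prior S \<theta>) \<partial>par_space S) = 0"
    by (subst nn_integral_0_iff_AE) auto
  then show False using prior_total by simp
qed

lemma
  shows T_hip_nonneg: "0 \<le> T_hip S" and T_hin_nonneg: "0 \<le> T_hin S"
    and W_nonneg: "0 \<le> W S" and W_fp_nonneg: "0 \<le> W_fp S" and W_fn_nonneg: "0 \<le> W_fn S"
  unfolding T_hip_def T_hin_def W_def W_fp_def W_fn_def
  by (intro Bochner_Integration.integral_nonneg mult_nonneg_nonneg importance_nonneg divide_nonneg_nonneg;
      auto simp: space_pair_law less_imp_le cost_hi_pos)+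

text \<open>Since the cost is positive, a zero mean over \<open>A\<close> makes the event
  \<open>yl \<in> A\<close> null for almost every \<theta> with positive \<open>importance\<close>,
  and \<open>P\<close> lies inside that event. \<open>A\<close> is cut with the space because it
  will also be \<open>- Omega S\<close>, which reaches outside it.\<close>

lemma W_eq_0_if_T_hi_eq_0:
  assumes A[measurable]: "A \<inter> space (data_space S) \<in> sets (data_space S)"
    and T: "(\<integral>\<theta>. (\<integral>(yl, y). cost_hi S \<theta> yl y * indicator A yl \<partial>pair_law S \<theta>)
      * importance S \<theta> \<partial>par_space S) = 0"
    and P: "\<And>yl y. P yl y \<Longrightarrow> yl \<in> A"
  shows "(\<integral>\<theta>. (prior S \<theta>)\<^sup>2 / importance S \<theta> *
    measure (pair_law S \<theta>) {(yl, y) \<in> space (pair_law S \<theta>). P yl y} \<partial>par_space S) = 0"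
proof -
  have ind: "indicator A yl = (indicator (A \<inter> space (data_space S)) yl :: real)"
    if "yl \<in> space (data_space S)" for yl
    using that by (simp add: indicator_def)
  have [measurable]: "(\<lambda>x. cost_hi S (fst x) (fst (snd x)) (snd (snd x)))
      \<in> borel_measurable (par_space S \<Otimes>\<^sub>M data_space S \<Otimes>\<^sub>M data_space S)"
    using cost_hi_measurable by (simp add: case_prod_beta')
  have meas: "(\<lambda>(\<theta>, yl, y). cost_hi S \<theta> yl y * indicator A yl)
      \<in> borel_measurable (par_space S \<Otimes>\<^sub>M data_space S \<Otimes>\<^sub>M data_space S)"
  proof -
    have "(\<lambda>(\<theta>, yl, y). cost_hi S \<theta> yl y * indicator (A \<inter> space (data_space S)) yl)
        \<in> borel_measurable (par_space S \<Otimes>\<^sub>M data_space S \<Otimes>\<^sub>M data_space S)"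
      by measurable
    then show ?thesis
      by (rule measurable_cong[THEN iffD1, rotated]) (auto simp: space_pair_measure ind)
  qed
  have "(\<integral>\<^sup>+\<theta>. (\<integral>\<^sup>+(yl, y). ennreal (cost_hi S \<theta> yl y * indicator A yl) \<partial>pair_law S \<theta>)
        * ennreal (importance S \<theta>) \<partial>par_space S)
      \<le> (\<integral>\<^sup>+\<theta>. (\<integral>\<^sup>+(yl, y). ennreal (cost_hi S \<theta> yl y) \<partial>pair_law S \<theta>)
        * ennreal (importance S \<theta>) \<partial>par_space S)"
    by (intro nn_integral_mono mult_right_mono)
      (auto simp: indicator_def space_pair_law split: prod.splits)
  also note T_hi_finite
  finally have "AE \<theta> in par_space S. 0 < importance S \<theta>
      \<longrightarrow> (AE (yl, y) in pair_law S \<theta>. cost_hi S \<theta> yl y * indicator A yl = 0)"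
    using T by (intro mean_cost_eq_0D meas) (auto simp: less_imp_le cost_hi_pos)
  then have "AE \<theta> in par_space S. (prior S \<theta>)\<^sup>2 / importance S \<theta> *
    measure (pair_law S \<theta>) {(yl, y) \<in> space (pair_law S \<theta>). P yl y} = 0"
  proof (rule AE_mp, intro AE_I2 impI)
    fix \<theta> assume \<theta>: "\<theta> \<in> space (par_space S)"
      and zero: "0 < importance S \<theta> \<longrightarrow> (AE (yl, y) in pair_law S \<theta>. cost_hi S \<theta> yl y * indicator A yl = 0)"
    show "(prior S \<theta>)\<^sup>2 / importance S \<theta> *
      measure (pair_law S \<theta>) {(yl, y) \<in> space (pair_law S \<theta>). P yl y} = 0"
    \<comment> \<open>Where \<open>importance\<close> is zero, division by zero makes the weight
      0.\<close>
    proof (cases "importance S \<theta> = 0")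
      case False
      with importance_nonneg[OF \<theta>] have "0 < importance S \<theta>" by simp
      with zero have "AE z in pair_law S \<theta>. (case z of (yl, y) \<Rightarrow> cost_hi S \<theta> yl y * indicator A yl = 0)"
        by simp
      then have "AE z in pair_law S \<theta>. \<not> (case z of (yl, y) \<Rightarrow> P yl y)"
      proof (rule AE_mp, intro AE_I2 impI)
        fix z assume "z \<in> space (pair_law S \<theta>)"
          "case z of (yl, y) \<Rightarrow> cost_hi S \<theta> yl y * indicator A yl = 0"
        then show "\<not> (case z of (yl, y) \<Rightarrow> P yl y)"
          using cost_hi_pos[OF \<theta>] P by (force simp: space_pair_law)
      qed
      then have "emeasure (pair_law S \<theta>) {z \<in> space (pair_law S \<theta>). case z of (yl, y) \<Rightarrow> P yl y} = 0"
        by (rule emeasure_eq_0_AE)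
      moreover have "{z \<in> space (pair_law S \<theta>). case z of (yl, y) \<Rightarrow> P yl y}
          = {(yl, y) \<in> space (pair_law S \<theta>). P yl y}" by auto
      ultimately show ?thesis by (simp add: measure_def)
    qed simp
  qed
  then show ?thesis by (rule integral_eq_zero_AE)
qed

lemma T_hip_pos: "0 < T_hip S" if "0 < W_fp S"
proof -
  have "T_hip S \<noteq> 0"
    using W_eq_0_if_T_hi_eq_0[of "Omega S" "\<lambda>yl y. yl \<in> Omega S \<and> y \<notin> Omega S"] that
    by (auto simp: W_fp_def T_hip_def)
  with T_hip_nonneg show ?thesis by simp
qed

lemma T_hin_pos: "0 < T_hin S" if "0 < W_fn S"
proof -
  have "- Omega S \<inter> space (data_space S) = space (data_space S) - Omega S" by auto
  then have "T_hin S \<noteq> 0"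
    using W_eq_0_if_T_hi_eq_0[of "- Omega S" "\<lambda>yl y. yl \<notin> Omega S \<and> y \<in> Omega S"] that
    by (auto simp: W_fn_def T_hin_def)
  with T_hin_nonneg show ?thesis by simp
qed

text \<open>The analytic results become available for the model; the condition on
  \<open>E + p + n\<close> is \<open>0 \<le> W S\<close>.\<close>

sublocale efficiency "W S - W_fp S - W_fn S" "W_fp S" "W_fn S" "T_lo S" "T_hip S" "T_hin S"
  using T_lo_pos W_nonneg W_fp_nonneg W_fn_nonneg T_hip_nonneg T_hin_nonneg T_hip_pos T_hin_pos
  by unfold_locales auto

section \<open>Back to the notation of the model\<close>

lemma phi_eq_F: "phi S (x, y) = F x y"
proof -
  have "W S + (1 / x - 1) * W_fp S + (1 / y - 1) * W_fn S
      = W S - W_fp S - W_fn S + W_fp S / x + W_fn S / y"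
    by (simp add: algebra_simps)
  then show ?thesis by (simp add: phi_def F_def mult.commute)
qed

lemma eta1_eq_clamp1: "eta1 S r y = clamp1 r y"
proof -
  have "W S - W_fp S - (1 - 1 / y) * W_fn S = W S - W_fp S - W_fn S + W_fn S / y"
    by (simp add: algebra_simps)
  then show ?thesis unfolding eta1_def clamp1_def Let_def by (simp only:)
qed

lemma eta2_eq_clamp2: "eta2 S r x = clamp2 r x"
proof -
  have "W S - (1 - 1 / x) * W_fp S - W_fn S = W S - W_fp S - W_fn S + W_fp S / x"
    by (simp add: algebra_simps)
  then show ?thesis unfolding eta2_def clamp2_def Let_def by (simp only:)
qed

lemma edge_points_subset:
  assumes "0 < r1" "r1 < 1" "0 < r2" "r2 < 1"
  shows "edge_points S r1 r2 \<subseteq> H_box r1 r2"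
  using assms clamp_bounds[of r1] clamp_bounds[of r2]
  by (auto simp: edge_points_def H_box_def eta1_eq_clamp1 eta2_eq_clamp2)

text \<open>If \<open>W_fp\<close> or \<open>W_fn\<close> were zero, \<open>eta_bar\<close> would
  lie on an axis, outside the open quadrant; hence the positivity assumptions.\<close>

lemma quadrant_minimum:
  assumes "W_fp S + W_fn S < W S" "0 < W_fp S" "0 < W_fn S"
  shows "phi S (eta_bar S) = phi_bar S" "\<And>x y. 0 < x \<Longrightarrow> 0 < y \<Longrightarrow> phi_bar S \<le> phi S (x, y)"
    "0 < fst (eta_bar S)" "0 < snd (eta_bar S)"
  using cauchy_schwarz_bound assms by (simp_all add: phi_bar_def eta_bar_def phi_eq_F)

lemma quadrant_minimiser_unique:
  assumes "W_fp S + W_fn S < W S" "0 < W_fp S" "0 < W_fn S"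
  shows "is_arg_min (phi S) (\<lambda>\<eta>. \<eta> \<in> {0<..} \<times> {0<..}) \<eta> \<longleftrightarrow> \<eta> = eta_bar S"
proof
  assume "is_arg_min (phi S) (\<lambda>\<eta>. \<eta> \<in> {0<..} \<times> {0<..}) \<eta>"
  then obtain x y where "\<eta> = (x, y)" and pos: "0 < x" "0 < y"
    and min: "\<And>s t. 0 < s \<Longrightarrow> 0 < t \<Longrightarrow> F x y \<le> F s t"
    by (cases \<eta>) (auto simp: is_arg_min_linorder phi_eq_F)
  then show "\<eta> = eta_bar S"
    using stationary_unique[OF pos global_minimiser_stationary[OF pos min]] assms
    by (simp add: eta_bar_def)
next
  assume "\<eta> = eta_bar S"
  then show "is_arg_min (phi S) (\<lambda>\<eta>. \<eta> \<in> {0<..} \<times> {0<..}) \<eta>"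
    using quadrant_minimum[OF assms] by (auto simp: is_arg_min_linorder mem_Times_iff)
qed

text \<open>A minimiser would be stationary, forcing \<open>E > 0\<close>. If \<open>W_fp\<close>
  and \<open>W_fn\<close> were both zero, then \<open>W\<close> would be zero too and
  \<open>phi\<close> constantly zero, with every point a minimiser; the second assumption excludes
  this.\<close>

lemma quadrant_no_minimiser:
  assumes "W S \<le> W_fp S + W_fn S" "0 < W_fp S + W_fn S"
  shows "\<not> is_arg_min (phi S) (\<lambda>\<eta>. \<eta> \<in> {0<..} \<times> {0<..}) \<eta>"
proof
  assume "is_arg_min (phi S) (\<lambda>\<eta>. \<eta> \<in> {0<..} \<times> {0<..}) \<eta>"
  then obtain x y where pos: "0 < x" "0 < y"
    and min: "\<And>s t. 0 < s \<Longrightarrow> 0 < t \<Longrightarrow> F x y \<le> F s t"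
    by (cases \<eta>) (auto simp: is_arg_min_linorder phi_eq_F)
  show False
    using stationary_E_pos[OF pos global_minimiser_stationary[OF pos min]] assms by simp
qed

lemma eta_star_minimises:
  assumes r: "0 < r1" "r1 < 1" "0 < r2" "r2 < 1"
  shows "eta_star S r1 r2 \<noteq> {}"
    and "\<eta> \<in> eta_star S r1 r2 \<Longrightarrow> \<eta> \<in> H_box r1 r2 \<and> phi S \<eta> = phi_star S r1 r2"
    and "\<eta> \<in> H_box r1 r2 \<Longrightarrow> phi_star S r1 r2 \<le> phi S \<eta>"
proof -
  have "eta_star S r1 r2 \<noteq> {} \<and> (\<forall>\<eta> \<in> eta_star S r1 r2. \<eta> \<in> H_box r1 r2 \<and> phi S \<eta> = phi_star S r1 r2)
    \<and> (\<forall>\<eta> \<in> H_box r1 r2. phi_star S r1 r2 \<le> phi S \<eta>)"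
  proof (cases "bar_in_H S r1 r2")
    case True
    then have E: "W_fp S + W_fn S < W S" and H: "eta_bar S \<in> H_box r1 r2"
      by (simp_all add: bar_in_H_def)
    \<comment> \<open>The coordinates of \<open>eta_bar\<close> are at least \<open>r1\<close> and
      \<open>r2\<close>, hence nonzero. So the quadrant result applies, and the box lies in the
      quadrant.\<close>
    have "W_fp S \<noteq> 0" "W_fn S \<noteq> 0" using H r by (auto simp: eta_bar_def H_box_def)
    then have "0 < W_fp S" "0 < W_fn S" using W_fp_nonneg W_fn_nonneg by simp_all
    then show ?thesis
      using quadrant_minimum[OF E] True H r
      by (auto simp: eta_star_def phi_star_def H_box_def)
  next
    case False
    let ?M = "Min (phi S ` edge_points S r1 r2)"
    have fin: "finite (edge_points S r1 r2)" and ne: "edge_points S r1 r2 \<noteq> {}"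
      by (simp_all add: edge_points_def)
    have star: "phi_star S r1 r2 = ?M" using False by (simp add: phi_star_def)
    have "?M \<in> phi S ` edge_points S r1 r2" using fin ne by (intro Min_in) auto
    then obtain \<eta> where "\<eta> \<in> edge_points S r1 r2" "phi S \<eta> = ?M" by (metis imageE)
    then have "\<eta> \<in> eta_star S r1 r2" using False by (simp add: eta_star_def star)
    then have "eta_star S r1 r2 \<noteq> {}" by blast
    \<comment> \<open>The negation of \<open>bar_in_H\<close> is the hypothesis
      \<open>outside\<close> of \<open>edge_minimum_box\<close>.\<close>
    moreover obtain x y where e: "(x, y) \<in> edge_points S r1 r2"
      and min: "\<And>s t. s \<in> {r1..1} \<Longrightarrow> t \<in> {r2..1} \<Longrightarrow> F x y \<le> F s t"
      using edge_minimum_box[OF r] False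
      unfolding edge_points_def eta1_eq_clamp1 eta2_eq_clamp2
      by (auto simp: bar_in_H_def eta_bar_def H_box_def)
    have "?M \<le> phi S (x, y)" using fin e by simp
    then have "\<forall>\<eta> \<in> H_box r1 r2. ?M \<le> phi S \<eta>"
      using min by (force simp: H_box_def phi_eq_F)
    ultimately show ?thesis
      using edge_points_subset[OF r] False by (auto simp: star eta_star_def)
  qed
  then show "eta_star S r1 r2 \<noteq> {}"
    and "\<eta> \<in> eta_star S r1 r2 \<Longrightarrow> \<eta> \<in> H_box r1 r2 \<and> phi S \<eta> = phi_star S r1 r2"
    and "\<eta> \<in> H_box r1 r2 \<Longrightarrow> phi_star S r1 r2 \<le> phi S \<eta>" by blast+
qed

end

theorem proposition4p4:
  fixes S :: "('t, 'y) mf_model" and \<rho>1 \<rho>2 :: real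
  assumes "mf_setting S"
    and "0 < \<rho>1" "\<rho>1 < 1" "0 < \<rho>2" "\<rho>2 < 1"
  shows "(W S > W_fp S + W_fn S \<and> W_fp S > 0 \<and> W_fn S > 0 \<longrightarrow>
            phi S (eta_bar S) = phi_bar S \<and>
            (\<forall>\<eta>. is_arg_min (phi S) (\<lambda>\<eta>. \<eta> \<in> {0<..} \<times> {0<..}) \<eta> \<longleftrightarrow> \<eta> = eta_bar S))
       \<and> (W S \<le> W_fp S + W_fn S \<and> W_fp S + W_fn S > 0 \<longrightarrow>
            \<not> (\<exists>\<eta>. is_arg_min (phi S) (\<lambda>\<eta>. \<eta> \<in> {0<..} \<times> {0<..}) \<eta>))
       \<and> phi_star S \<rho>1 \<rho>2 \<in> phi S ` H_box \<rho>1 \<rho>2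
       \<and> (\<forall>\<eta> \<in> H_box \<rho>1 \<rho>2. phi_star S \<rho>1 \<rho>2 \<le> phi S \<eta>)
       \<and> eta_star S \<rho>1 \<rho>2 \<noteq> {}
       \<and> (\<forall>\<eta> \<in> eta_star S \<rho>1 \<rho>2.
            phi S \<eta> = phi_star S \<rho>1 \<rho>2 \<and> is_arg_min (phi S) (\<lambda>\<eta>. \<eta> \<in> H_box \<rho>1 \<rho>2) \<eta>)"
proof -
  interpret mf_setting S by fact
  note star = eta_star_minimises[OF assms(2-5)]
  have "phi_star S \<rho>1 \<rho>2 \<in> phi S ` H_box \<rho>1 \<rho>2"
    using star(1,2) by (metis ex_in_conv imageI)
  moreover have "is_arg_min (phi S) (\<lambda>\<eta>. \<eta> \<in> H_box \<rho>1 \<rho>2) \<eta>" if "\<eta> \<in> eta_star S \<rho>1 \<rho>2" for \<eta>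
    using star(2)[OF that] star(3) by (simp add: is_arg_min_linorder)
  ultimately show ?thesis
    using star quadrant_minimum(1) quadrant_minimiser_unique quadrant_no_minimiser by blast
qed

end
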